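(* Suppose that assumptions $(A1)$, $(A2)$, $(A3)$ and $(A4)$ (stated in the context) hold. Then the iterations of the greedy algorithm are well-defined, in the sense that for every $n\in\mathbb{N}^*$ the minimization problem $$\min_{(r,s)\in V_t\times V_x} \mathcal{E}\left(\sum_{k=1}^{n-1} r_k\otimes s_k + r\otimes s\right)$$ has at least one minimizer $(r_n,s_n)\in V_t\times V_x$ (where $(r_1,s_1),\dots,(r_{n-1},s_{n-1})$ are the minimizers chosen at the previous iterations). Moreover, for any sequence $((r_n,s_n))_{n\in\mathbb{N}^*}$ generated by the algorithm, the sequence $u_n=\sum_{k=1}^n r_k\otimes s_k$ converges strongly in $V$ to $u$, the unique global minimizer of $\mathcal{E}$ on $V$.
   Context: Let $p,d$ be positive integers and $\mathcal{T}\subset\mathbb{R}^p$, $\mathcal{X}\subset\mathbb{R}^d$ open sets. $V_t$ and $V_x$ are Hilbert spaces of real-valued functions on $\mathcal{T}$ and $\mathcal{X}$ respectively (typically $L^2$ or Sobolev spaces). For $(r,s)\in V_t\times V_x$, $r\otimes s$ is the function $(t,x)\mapsto r(t)s(x)$ on $\mathcal{T}\times\mathcal{X}$, and $\Sigma=\{r\otimes s \mid (r,s)\in V_t\times V_x\}$. $V$ is a Hilbert space of real-valued functions on $\mathcal{T}\times\mathcal{X}$ with scalar product $\langle\cdot,\cdot\rangle$ and norm $\|\cdot\|_V$. $\mathcal{E}:V\to\mathbb{R}$ is differentiable, and $\mathcal{E}'(v)\in V$ denotes its gradient at $v$. $\mathbb{N}^*=\{1,2,\dots\}$. Assumptions: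 - $(A1)$ $\mathrm{Span}(\Sigma)$ is a dense subset of $V$ for $\|\cdot\|_V$ (in particular $\Sigma\subset V$). - $(A2)$ For every sequence of elements of $\Sigma$ bounded in $V$, there is a subsequence converging weakly in $V$ to an element of $\Sigma$. - $(A3)$ $\mathcal{E}$ is strongly convex: there is $\alpha>0$ such that for all $v,w\in V$, $\mathcal{E}(v)\ge \mathcal{E}(w)+\langle \mathcal{E}'(w),v-w\rangle+\frac{\alpha}{2}\|v-w\|_V^2$. - $(A4)$ The gradient of $\mathcal{E}$ is Lipschitz on bounded sets: for each bounded $K\subset V$ there is $L_K\ge 0$ such that $\|\mathcal{E}'(v)-\mathcal{E}'(w)\|_V\le L_K\|v-w\|_V$ for all $v,w\in K$. Under these assumptions $\mathcal{E}$ has a unique global minimizer on $V$, denoted $u$. Greedy algorithm: recursively for $n\in\mathbb{N}^*$, choose $(r_n,s_n)\in\mathrm{argmin}_{(r,s)\in V_t\times V_x}\mathcal{E}\left(\sum_{k=1}^{n-1} r_k\otimes s_k+r\otimes s\right)$ (minimizers need not be unique). *)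

theory Defs
  imports "HOL-Analysis.Analysis"
begin

text \<open>
  Spaces such as \<open>L\<^sup>2\<close> or Sobolev spaces consist of functions up to equality almost everywhere,
  whereas, for instance, reproducing kernel Hilbert spaces consist of genuine functions. Both
  conventions for when two functions on \<open>\<Omega>\<close> are the same are covered.
\<close>

datatype identification = Pointwise | Almost_Everywhere

fun same_on :: "identification \<Rightarrow> 'a::euclidean_space set \<Rightarrow> ('a \<Rightarrow> real) \<Rightarrow> ('a \<Rightarrow> real) \<Rightarrow> bool" where
  "same_on Pointwise \<Omega> f g \<longleftrightarrow> (\<forall>x\<in>\<Omega>. f x = g x)"
| "same_on Almost_Everywhere \<Omega> f g \<longleftrightarrow> (AE x in lebesgue. x \<in> \<Omega> \<longrightarrow> f x = g x)"

text \<open>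
  A Hilbert space of real-valued functions on \<open>\<Omega>\<close> is a complete inner product space \<open>'v\<close> together
  with a map \<open>fn\<close> that gives for each element the function on \<open>\<Omega>\<close> that it is (or a representative
  of it, for \<open>Almost_Everywhere\<close>). Up to the chosen identification, the vector space operations of
  \<open>'v\<close> are those of functions, and an element is determined by its function. The values of
  \<open>fn v\<close> outside \<open>\<Omega>\<close> are irrelevant.
\<close>

definition hilbert_function_space ::
    "identification \<Rightarrow> 'a::euclidean_space set \<Rightarrow>
      ('v::{real_inner, complete_space} \<Rightarrow> 'a \<Rightarrow> real) \<Rightarrow> bool" where
  "hilbert_function_space m \<Omega> fn \<longleftrightarrow>
     (\<forall>v w. same_on m \<Omega> (fn (v + w)) (\<lambda>x. fn v x + fn w x)) \<and>
     (\<forall>c v. same_on m \<Omega> (fn (c *\<^sub>R v)) (\<lambda>x. c * fn v x)) \<and>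
     (\<forall>v w. same_on m \<Omega> (fn v) (fn w) \<longrightarrow> v = w)"

text \<open>
  \<open>tens r s\<close> is the element of \<open>V\<close> that is the function \<open>(t, x) \<mapsto> r(t) s(x)\<close>. Existence of such a
  \<open>tens\<close> says that every \<open>r \<otimes> s\<close> lies in \<open>V\<close>; it is unique if \<open>fn\<close> is the function map
  of a Hilbert function space.
\<close>

definition is_tensor_product ::
    "identification \<Rightarrow> 'a::euclidean_space set \<Rightarrow> 'b::euclidean_space set \<Rightarrow>
      ('vt \<Rightarrow> 'a \<Rightarrow> real) \<Rightarrow> ('vx \<Rightarrow> 'b \<Rightarrow> real) \<Rightarrow> ('v \<Rightarrow> 'a \<times> 'b \<Rightarrow> real) \<Rightarrow>
      ('vt \<Rightarrow> 'vx \<Rightarrow> 'v) \<Rightarrow> bool" where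
  "is_tensor_product m T X fn_t fn_x fn tens \<longleftrightarrow>
     (\<forall>r s. same_on m (T \<times> X) (fn (tens r s)) (\<lambda>(t, x). fn_t r t * fn_x s x))"

definition rank_one :: "('vt \<Rightarrow> 'vx \<Rightarrow> 'v) \<Rightarrow> 'v set" where
  "rank_one tens = {tens r s | r s. True}"

definition converges_weakly :: "(nat \<Rightarrow> 'v::real_inner) \<Rightarrow> 'v \<Rightarrow> bool" where
  "converges_weakly x l \<longleftrightarrow> (\<forall>w. (\<lambda>n. x n \<bullet> w) \<longlonglongrightarrow> l \<bullet> w)"

definition strongly_convex :: "('v::real_inner \<Rightarrow> real) \<Rightarrow> ('v \<Rightarrow> 'v) \<Rightarrow> bool" where
  "strongly_convex E E' \<longleftrightarrow>
     (\<exists>\<alpha>>0. \<forall>v w. E v \<ge> E w + E' w \<bullet> (v - w) + \<alpha> / 2 * (norm (v - w))\<^sup>2)"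

definition greedy_objective ::
    "('v::real_vector \<Rightarrow> real) \<Rightarrow> ('vt \<Rightarrow> 'vx \<Rightarrow> 'v) \<Rightarrow>
      (nat \<Rightarrow> 'vt) \<Rightarrow> (nat \<Rightarrow> 'vx) \<Rightarrow> nat \<Rightarrow> 'vt \<times> 'vx \<Rightarrow> real" where
  "greedy_objective E tens r s n = (\<lambda>(r', s'). E ((\<Sum>k=1..n - 1. tens (r k) (s k)) + tens r' s'))"

definition greedy_choice ::
    "('v::real_vector \<Rightarrow> real) \<Rightarrow> ('vt \<Rightarrow> 'vx \<Rightarrow> 'v) \<Rightarrow>
      (nat \<Rightarrow> 'vt) \<Rightarrow> (nat \<Rightarrow> 'vx) \<Rightarrow> nat \<Rightarrow> bool" where
  "greedy_choice E tens r s n \<longleftrightarrow>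
     is_arg_min (greedy_objective E tens r s n) (\<lambda>_. True) (r n, s n)"

end

theory Submission
  imports Defs
begin

text \<open>
  The rank-one elements form a cone \<open>S\<close> (a scalar can be absorbed in the first factor), and this is
  the only trace that the tensor product leaves in the argument. Everything else concerns a strongly
  convex functional \<open>E\<close> on a Hilbert space and a cone \<open>S\<close> with dense span in which bounded sequences
  have weakly convergent subsequences.

  Strong convexity makes \<open>E\<close> coercive and puts it above its tangent planes. A minimizing sequence
  of \<open>E\<close> on a translate of \<open>S\<close> is therefore bounded, and its weak limit point is a minimizer, since
  the tangent plane there is a weakly continuous minorant (lemma \<open>minimizer_on_translate\<close>). A
  minimizing sequence of \<open>E\<close> on the whole space is even Cauchy, by the midpoint inequality.

  For the convergence, let \<open>u\<^sub>n\<close> be the \<open>n\<close>-th iterate, starting from \<open>u\<^sub>0 = 0\<close>, and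
  \<open>a\<^sub>n = u\<^sub>n\<^sub>+\<^sub>1 - u\<^sub>n\<close> the \<open>n\<close>-th correction. Because \<open>S\<close> is a cone, the gradient at \<open>u\<^sub>n\<^sub>+\<^sub>1\<close> is
  orthogonal to \<open>a\<^sub>n\<close>, so each step lowers the energy by at least a multiple of \<open>\<parallel>a\<^sub>n\<parallel>\<^sup>2\<close>, and these
  squares are summable. Comparing \<open>a\<^sub>n\<close> with an arbitrary element of \<open>S\<close> of the same length, where
  the Lipschitz gradient bounds both energies to second order, yields
  \<open>\<bar>E'(u\<^sub>n) \<bullet> \<tau>\<bar> \<le> C \<parallel>a\<^sub>n\<parallel> \<parallel>\<tau>\<parallel>\<close> for all \<open>\<tau> \<in> S\<close> (lemma \<open>gradient_bound_on_cone\<close>): the length of the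
  next correction controls the gradient on the cone. By convexity, the excess energy satisfies
  \<open>E(u\<^sub>n) - E(u) \<le> E'(u\<^sub>n) \<bullet> u\<^sub>n - E'(u\<^sub>n) \<bullet> u\<close>. The second term tends to zero, because the bounded
  gradients tend to zero on \<open>S\<close>, whose span is dense. The first is at most
  \<open>C \<parallel>a\<^sub>n\<parallel> (\<parallel>a\<^sub>0\<parallel> + \<dots> + \<parallel>a\<^sub>n\<^sub>-\<^sub>1\<parallel>)\<close>, and this becomes arbitrarily small infinitely often by
  comparison with the harmonic series (lemma \<open>square_summable_mult_partial_sum_small\<close>). As the
  energies decrease, they converge to \<open>E(u)\<close>, and strong convexity turns this into convergence of
  the iterates in norm.
\<close>

section \<open>Two facts about sequences\<close>

text \<open>
  If the product stayed above \<open>\<epsilon>\<close>, the Cauchy-Schwarz bound \<open>O(\<surd>n)\<close> on the partial sums would force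
  \<open>(a n)\<^sup>2\<close> to be at least of order \<open>1/n\<close>. Only infinitely many small terms can be expected, not
  convergence to zero: a sparse sequence of larger terms is compatible with summable squares.
\<close>

lemma square_summable_mult_partial_sum_small:
  fixes a :: "nat \<Rightarrow> real"
  assumes nonneg: "\<And>n. 0 \<le> a n" and summ: "summable (\<lambda>n. (a n)\<^sup>2)" and "0 < \<epsilon>"
  shows "\<exists>n\<ge>N. a n * (\<Sum>k<n. a k) < \<epsilon>"
proof (rule ccontr)
  assume "\<not> ?thesis"
  then have large: "\<epsilon> \<le> a n * (\<Sum>k<n. a k)" if "n \<ge> N" for n
    using that by (meson not_le)
  define M where "M = (\<Sum>n. (a n)\<^sup>2)"
  have bound: "inverse (real n) \<le> (a n)\<^sup>2 * (M / \<epsilon>\<^sup>2)" if "n \<ge> N" for n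
  proof (cases "n = 0")
    case True
    have "0 \<le> M" unfolding M_def by (intro suminf_nonneg summ) simp
    with True show ?thesis by simp
  next
    case False
    have "\<epsilon>\<^sup>2 \<le> (a n * (\<Sum>k<n. a k))\<^sup>2"
      using large[OF that] \<open>0 < \<epsilon>\<close> by (intro power_mono) auto
    also have "\<dots> = (a n)\<^sup>2 * (\<Sum>k<n. a k)\<^sup>2"
      by (simp add: power_mult_distrib)
    also have "(\<Sum>k<n. a k)\<^sup>2 \<le> (\<Sum>k<n. (a k)\<^sup>2) * real n"
      using sum_squared_le_sum_of_squares[of a "{..<n}"] by simp
    also have "(\<Sum>k<n. (a k)\<^sup>2) \<le> M"
      unfolding M_def by (intro sum_le_suminf summ) auto
    finally have "\<epsilon>\<^sup>2 \<le> (a n)\<^sup>2 * (M * real n)"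
      by (simp add: mult_left_mono mult_right_mono)
    with False \<open>0 < \<epsilon>\<close> show ?thesis by (simp add: field_simps)
  qed
  have "summable (\<lambda>n. (a n)\<^sup>2 * (M / \<epsilon>\<^sup>2))"
    by (intro summable_mult2 summ)
  then have "summable (\<lambda>n. inverse (real n))"
    by (rule summable_comparison_test'[where N = N]) (use bound in simp)
  then show False
    using not_summable_harmonic[where 'a = real] by simp
qed

text \<open>
  The vectors against which \<open>G\<close> tends to zero form a subspace, which is closed because \<open>G\<close> is
  bounded.
\<close>

lemma inner_tendsto_zero_if_on_total_set:
  fixes G :: "nat \<Rightarrow> 'v::real_inner"
  assumes bound: "\<And>n. norm (G n) \<le> B"
    and null: "\<And>v. v \<in> S \<Longrightarrow> (\<lambda>n. G n \<bullet> v) \<longlonglongrightarrow> 0"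
    and total: "closure (span S) = UNIV"
  shows "(\<lambda>n. G n \<bullet> w) \<longlonglongrightarrow> 0"
proof (rule LIMSEQ_I)
  fix e :: real assume "0 < e"
  have "0 \<le> B" using bound[of 0] norm_ge_zero[of "G 0"] by linarith
  then have "B + 1 \<noteq> 0" by linarith
  have "w \<in> closure (span S)" using total by simp
  then obtain v where v: "v \<in> span S" "dist v w < (e / 2) / (B + 1)"
    using \<open>0 < e\<close> \<open>0 \<le> B\<close> unfolding closure_approachable
    by (metis add_nonneg_pos divide_pos_pos half_gt_zero zero_less_one)
  have "(\<lambda>n. G n \<bullet> v) \<longlonglongrightarrow> 0"
    using v(1)
  proof (induction rule: span_induct_alt)
    case base
    show ?case by simp
  next
    case (step c x y)
    have "(\<lambda>n. c * (G n \<bullet> x) + G n \<bullet> y) \<longlonglongrightarrow> c * 0 + 0"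
      by (intro tendsto_intros null step)
    then show ?case by (simp add: inner_add_right)
  qed
  then obtain N where N: "\<And>n. n \<ge> N \<Longrightarrow> \<bar>G n \<bullet> v\<bar> < e / 2"
    using \<open>0 < e\<close> by (metis LIMSEQ_D diff_zero half_gt_zero real_norm_def)
  have "norm (G n \<bullet> w - 0) < e" if "n \<ge> N" for n
  proof -
    have "\<bar>G n \<bullet> (w - v)\<bar> \<le> norm (G n) * norm (w - v)"
      by (rule Cauchy_Schwarz_ineq2)
    also have "\<dots> \<le> (B + 1) * ((e / 2) / (B + 1))"
      using bound[of n] v(2) \<open>0 \<le> B\<close>
      by (intro mult_mono) (auto simp: dist_norm norm_minus_commute)
    also have "\<dots> = e / 2" using \<open>B + 1 \<noteq> 0\<close>
      by (metis nonzero_mult_div_cancel_left times_divide_eq_right)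
    finally have "\<bar>G n \<bullet> w - G n \<bullet> v\<bar> \<le> e / 2" by (simp add: inner_diff_right)
    with N[OF that] show ?thesis unfolding real_norm_def diff_0_right by linarith
  qed
  then show "\<exists>N. \<forall>n\<ge>N. norm (G n \<bullet> w - 0) < e" by blast
qed

section \<open>Strongly convex functionals and their minimizers\<close>

locale strongly_convex_functional =
  fixes E :: "'v::{real_inner, complete_space} \<Rightarrow> real" and E' :: "'v \<Rightarrow> 'v" and \<alpha> :: real
  assumes gradient: "GDERIV E v :> E' v"
    and modulus_pos: "0 < \<alpha>"
    and above_tangent: "E w + E' w \<bullet> (v - w) + \<alpha> / 2 * (norm (v - w))\<^sup>2 \<le> E v"
begin

lemma above_tangent_plane: "E w + E' w \<bullet> (v - w) \<le> E v"
proof -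
  have "0 \<le> \<alpha> / 2 * (norm (v - w))\<^sup>2" using modulus_pos by simp
  with above_tangent[of w v] show ?thesis by linarith
qed

lemma isCont: "isCont E v"
  using gradient[of v] unfolding gderiv_def by (rule has_derivative_continuous)

text \<open>Completing the square in the quadratic lower bound at \<open>0\<close>.\<close>

lemma above_paraboloid:
  "E 0 - (norm (E' 0))\<^sup>2 / (2 * \<alpha>) + \<alpha> / 2 * (norm (v + E' 0 /\<^sub>R \<alpha>))\<^sup>2 \<le> E v"
proof -
  have "(norm (v + E' 0 /\<^sub>R \<alpha>))\<^sup>2
      = (norm v)\<^sup>2 + 2 * (E' 0 \<bullet> v) / \<alpha> + (norm (E' 0))\<^sup>2 / (\<alpha> * \<alpha>)"
    unfolding power2_norm_eq_inner
    by (simp add: inner_add_left inner_add_right inner_commute divide_simps)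
      (simp add: algebra_simps)
  then have "\<alpha> / 2 * (norm (v + E' 0 /\<^sub>R \<alpha>))\<^sup>2
      = E' 0 \<bullet> v + \<alpha> / 2 * (norm v)\<^sup>2 + (norm (E' 0))\<^sup>2 / (2 * \<alpha>)"
    using modulus_pos by (simp add: field_simps)
  moreover have "E 0 + E' 0 \<bullet> v + \<alpha> / 2 * (norm v)\<^sup>2 \<le> E v"
    using above_tangent[of 0 v] by simp
  ultimately show ?thesis by linarith
qed

lemma lower_bound: "E 0 - (norm (E' 0))\<^sup>2 / (2 * \<alpha>) \<le> E v"
proof -
  have "0 \<le> \<alpha> / 2 * (norm (v + E' 0 /\<^sub>R \<alpha>))\<^sup>2" using modulus_pos by simp
  with above_paraboloid[of v] show ?thesis by linarith
qed

lemma bounded_sublevel: "bounded {v. E v \<le> c}"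
proof -
  define D where "D = 2 / \<alpha> * (c - E 0 + (norm (E' 0))\<^sup>2 / (2 * \<alpha>))"
  have "norm v \<le> sqrt D + norm (E' 0 /\<^sub>R \<alpha>)" if "E v \<le> c" for v
  proof -
    have "\<alpha> / 2 * (norm (v + E' 0 /\<^sub>R \<alpha>))\<^sup>2 \<le> c - E 0 + (norm (E' 0))\<^sup>2 / (2 * \<alpha>)"
      using above_paraboloid[of v] that by linarith
    then have "(norm (v + E' 0 /\<^sub>R \<alpha>))\<^sup>2 \<le> D"
      using modulus_pos unfolding D_def by (simp add: field_simps)
    then have "norm (v + E' 0 /\<^sub>R \<alpha>) \<le> sqrt D" by (rule real_le_rsqrt)
    moreover have "norm v \<le> norm (v + E' 0 /\<^sub>R \<alpha>) + norm (E' 0 /\<^sub>R \<alpha>)"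
      using norm_triangle_ineq4[of "v + E' 0 /\<^sub>R \<alpha>" "E' 0 /\<^sub>R \<alpha>"] by simp
    ultimately show ?thesis by linarith
  qed
  then show ?thesis unfolding bounded_iff by blast
qed

text \<open>The gradient terms of the two tangent inequalities at the midpoint cancel.\<close>

lemma midpoint: "\<alpha> / 4 * (norm (v - w))\<^sup>2 \<le> E v + E w - 2 * E ((v + w) /\<^sub>R 2)"
proof -
  let ?m = "(v + w) /\<^sub>R 2" and ?h = "(v - w) /\<^sub>R 2"
  have v: "v - ?m = ?h" and w: "w - ?m = - ?h"
    using scaleR_half_double[of v] scaleR_half_double[of w] by (simp_all add: algebra_simps)
  have half: "\<alpha> / 2 * (norm ?h)\<^sup>2 = (\<alpha> / 4 * (norm (v - w))\<^sup>2) / 2"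
    by (simp add: power_divide)
  have "E ?m + E' ?m \<bullet> ?h + (\<alpha> / 4 * (norm (v - w))\<^sup>2) / 2 \<le> E v"
    "E ?m - E' ?m \<bullet> ?h + (\<alpha> / 4 * (norm (v - w))\<^sup>2) / 2 \<le> E w"
    using above_tangent[of ?m v] above_tangent[of ?m w]
    by (simp_all only: v w half inner_minus_right norm_minus_cancel add_uminus_conv_diff)
  then show ?thesis by linarith
qed

lemma dist_minimizer:
  assumes "\<And>v. E u \<le> E v"
  shows "\<alpha> / 4 * (norm (v - u))\<^sup>2 \<le> E v - E u"
  using midpoint[of v u] assms[of "(v + u) /\<^sub>R 2"] by linarith

lemma minimizing_sequence:
  assumes "A \<noteq> {}"
  obtains I x where "\<And>v. v \<in> A \<Longrightarrow> I \<le> E v"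
    and "\<And>n. x n \<in> A" and "\<And>n. E (x n) < I + inverse (real (Suc n))"
proof -
  define I where "I = Inf (E ` A)"
  have bdd: "bdd_below (E ` A)"
    using lower_bound by (auto intro!: bdd_belowI)
  have "\<exists>v\<in>A. E v < I + inverse (real (Suc n))" for n
  proof (rule ccontr)
    assume "\<not> ?thesis"
    then have "I + inverse (real (Suc n)) \<le> I"
      unfolding I_def using assms by (intro cInf_greatest) (auto simp: I_def not_less)
    then show False by simp
  qed
  then obtain x where "\<And>n. x n \<in> A" "\<And>n. E (x n) < I + inverse (real (Suc n))"
    by metis
  moreover have "I \<le> E v" if "v \<in> A" for v
    unfolding I_def using that bdd by (intro cInf_lower) auto
  ultimately show thesis using that by blast
qed

text \<open>The midpoint of two almost minimizers cannot be lower than the infimum, so they are close.\<close>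

lemma minimizer: "\<exists>u. \<forall>v. E u \<le> E v"
proof -
  obtain I x where I: "\<And>v. I \<le> E v" and x: "\<And>n. E (x n) < I + inverse (real (Suc n))"
    by (rule minimizing_sequence[of UNIV]) auto
  have "Cauchy x"
  proof (rule metric_CauchyI)
    fix e :: real assume "0 < e"
    then have "0 < (\<alpha> / 4 * e\<^sup>2) / 2" using modulus_pos by simp
    then obtain N where N: "inverse (real (Suc N)) < (\<alpha> / 4 * e\<^sup>2) / 2"
      using reals_Archimedean by blast
    have "dist (x i) (x j) < e" if "N \<le> i" "N \<le> j" for i j
    proof -
      have "inverse (real (Suc i)) \<le> inverse (real (Suc N))"
        "inverse (real (Suc j)) \<le> inverse (real (Suc N))"
        using that by (auto intro!: le_imp_inverse_le)
      then have "\<alpha> / 4 * (norm (x i - x j))\<^sup>2 < \<alpha> / 4 * e\<^sup>2"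
        using midpoint[of "x i" "x j"] I[of "(x i + x j) /\<^sub>R 2"] x[of i] x[of j] N by linarith
      then have "(norm (x i - x j))\<^sup>2 < e\<^sup>2" using modulus_pos by simp
      then show ?thesis using \<open>0 < e\<close> by (simp add: dist_norm power_less_imp_less_base)
    qed
    then show "\<exists>N. \<forall>i\<ge>N. \<forall>j\<ge>N. dist (x i) (x j) < e" by blast
  qed
  then obtain u where "x \<longlonglongrightarrow> u"
    using Cauchy_convergent unfolding convergent_def by blast
  then have "(\<lambda>n. E (x n)) \<longlonglongrightarrow> E u"
    by (rule isCont_tendsto_compose[OF isCont])
  moreover have "(\<lambda>n. I + inverse (real (Suc n))) \<longlonglongrightarrow> I + 0"
    by (intro tendsto_intros LIMSEQ_inverse_real_of_nat)
  ultimately have "E u \<le> I + 0"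
    by (rule LIMSEQ_le) (intro exI allI impI less_imp_le x)
  then have "E u \<le> E v" for v using I[of v] by linarith
  then show ?thesis by blast
qed

lemma is_arg_min_iff:
  assumes "\<And>v. E u \<le> E v"
  shows "is_arg_min E (\<lambda>_. True) v \<longleftrightarrow> v = u"
proof
  assume "is_arg_min E (\<lambda>_. True) v"
  then have "E v \<le> E u" by (auto simp: is_arg_min_def not_less)
  with dist_minimizer[OF assms, of v] have "\<alpha> / 4 * (norm (v - u))\<^sup>2 \<le> 0" by linarith
  then show "v = u" using modulus_pos by (simp add: mult_le_0_iff)
qed (use assms in \<open>auto simp: is_arg_min_def not_less\<close>)

text \<open>
  The tangent plane at the weak limit of a minimizing sequence is an affine minorant of \<open>E\<close>, and
  weak convergence is exactly what makes its values along the sequence converge.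
\<close>

lemma minimizer_on_translate:
  assumes "S \<noteq> {}"
    and compact: "\<And>\<sigma> :: nat \<Rightarrow> 'v. (\<And>n. \<sigma> n \<in> S) \<Longrightarrow> bounded (range \<sigma>) \<Longrightarrow>
      \<exists>l\<in>S. \<exists>\<phi>. strict_mono \<phi> \<and> converges_weakly (\<sigma> \<circ> \<phi>) l"
  shows "\<exists>l\<in>S. \<forall>\<tau>\<in>S. E (w + l) \<le> E (w + \<tau>)"
proof -
  obtain I x where I: "\<And>v. v \<in> (+) w ` S \<Longrightarrow> I \<le> E v" and x: "\<And>n. x n \<in> (+) w ` S"
    and lim: "\<And>n. E (x n) < I + inverse (real (Suc n))"
    by (rule minimizing_sequence[of "(+) w ` S"]) (use assms(1) in auto)
  define \<sigma> where "\<sigma> n = x n - w" for n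
  have in_S: "\<sigma> n \<in> S" for n using x[of n] unfolding \<sigma>_def by auto
  have "bounded (range \<sigma>)"
  proof -
    have "E (x n) \<le> I + 1" for n
      using lim[of n] inverse_le_1_iff[of "real (Suc n)"] by simp
    then have "range x \<subseteq> {v. E v \<le> I + 1}" by auto
    then have "bounded (range x)" by (rule bounded_subset[OF bounded_sublevel])
    then have "bounded ((\<lambda>v. v - w) ` range x)" by (rule bounded_translation_minus)
    then show ?thesis by (simp add: \<sigma>_def image_image)
  qed
  then obtain l \<phi> where l: "l \<in> S" "strict_mono \<phi>" "converges_weakly (\<sigma> \<circ> \<phi>) l"
    using compact[of \<sigma>, OF in_S] by blast
  let ?g = "E' (w + l)"
  have tangent_lim: "(\<lambda>n. E (w + l) + ((\<sigma> \<circ> \<phi>) n \<bullet> ?g - l \<bullet> ?g)) \<longlonglongrightarrow> E (w + l) + (l \<bullet> ?g - l \<bullet> ?g)"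
    using l(3) unfolding converges_weakly_def by (intro tendsto_add tendsto_diff tendsto_const) simp
  have energy_lim: "(\<lambda>n. I + inverse (real (Suc (\<phi> n)))) \<longlonglongrightarrow> I + 0"
    using LIMSEQ_subseq_LIMSEQ[OF LIMSEQ_inverse_real_of_nat l(2)]
    by (intro tendsto_intros) (simp add: o_def)
  have "E (w + l) + ((\<sigma> \<circ> \<phi>) n \<bullet> ?g - l \<bullet> ?g) \<le> I + inverse (real (Suc (\<phi> n)))" for n
  proof -
    have diff: "x (\<phi> n) - (w + l) = \<sigma> (\<phi> n) - l" by (simp add: \<sigma>_def)
    have "E (w + l) + ?g \<bullet> (\<sigma> (\<phi> n) - l) \<le> E (x (\<phi> n))"
      using above_tangent_plane[of "w + l" "x (\<phi> n)"] unfolding diff .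
    with lim[of "\<phi> n"] show ?thesis by (simp add: inner_diff_right inner_commute)
  qed
  then have "E (w + l) + (l \<bullet> ?g - l \<bullet> ?g) \<le> I + 0"
    by (intro LIMSEQ_le[OF tangent_lim energy_lim] exI allI impI)
  with I l(1) show ?thesis by force
qed

section \<open>One greedy step\<close>

lemma gradient_orthogonal_if_line_minimum:
  assumes "\<And>t. E v \<le> E (v + t *\<^sub>R h)"
  shows "E' v \<bullet> h = 0"
proof -
  have "(E has_derivative (\<lambda>k. k \<bullet> E' v)) (at (v + 0 *\<^sub>R h))"
    using gradient[of v] by (simp add: gderiv_def)
  then have "((\<lambda>t. E (v + t *\<^sub>R h)) has_derivative (\<lambda>t. (t *\<^sub>R h) \<bullet> E' v)) (at 0)"
    by (rule has_derivative_compose[rotated]) (auto intro!: derivative_eq_intros)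
  then have "DERIV (\<lambda>t. E (v + t *\<^sub>R h)) 0 :> h \<bullet> E' v"
    by (simp add: has_field_derivative_def mult_commute_abs)
  then have "h \<bullet> E' v = 0"
    by (rule DERIV_local_min[where d = 1]) (use assms in auto)
  then show ?thesis by (simp add: inner_commute)
qed

text \<open>
  Convexity at \<open>v + h\<close> bounds \<open>E (v + h)\<close> by \<open>E v + E' (v + h) \<bullet> h\<close>, which avoids integrating the
  gradient, at the price of \<open>L\<close> instead of the optimal \<open>L / 2\<close>.
\<close>

lemma quadratic_upper_bound:
  assumes "L-lipschitz_on K E'" "v \<in> K" "v + h \<in> K"
  shows "E (v + h) \<le> E v + E' v \<bullet> h + L * (norm h)\<^sup>2"
proof -
  have "E (v + h) \<le> E v + E' (v + h) \<bullet> h"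
    using above_tangent_plane[of "v + h" v] by simp
  also have "\<dots> = E v + E' v \<bullet> h + (E' (v + h) - E' v) \<bullet> h"
    by (simp add: inner_diff_left)
  also have "(E' (v + h) - E' v) \<bullet> h \<le> norm (E' (v + h) - E' v) * norm h"
    by (rule norm_cauchy_schwarz)
  also have "norm (E' (v + h) - E' v) \<le> L * norm h"
    using lipschitz_onD[OF assms(1,3,2)] by (simp add: dist_norm)
  finally show ?thesis
    by (simp add: power2_eq_square mult_right_mono mult.assoc)
qed

context
  fixes S :: "'v set" and v d :: 'v
  assumes cone: "\<And>c x. x \<in> S \<Longrightarrow> c *\<^sub>R x \<in> S"
    and step: "d \<in> S" and step_optimal: "\<And>\<tau>. \<tau> \<in> S \<Longrightarrow> E (v + d) \<le> E (v + \<tau>)"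
begin

lemma gradient_orthogonal_to_step: "E' (v + d) \<bullet> d = 0"
proof (rule gradient_orthogonal_if_line_minimum)
  fix t
  have "E (v + d) \<le> E (v + (1 + t) *\<^sub>R d)" using step step_optimal cone by blast
  then show "E (v + d) \<le> E (v + d + t *\<^sub>R d)" by (simp add: scaleR_add_left add.assoc)
qed

lemma energy_drop: "\<alpha> / 2 * (norm d)\<^sup>2 \<le> E v - E (v + d)"
  using above_tangent[of "v + d" v] gradient_orthogonal_to_step by simp

text \<open>
  Competing against the multiples \<open>h\<close> of \<open>\<tau>\<close> with \<open>\<parallel>h\<parallel> = \<parallel>d\<parallel>\<close>: the step \<open>d\<close> gains at most
  \<open>L \<parallel>d\<parallel>\<^sup>2\<close>, since the gradient is orthogonal to \<open>d\<close> at the end of the step, whereas \<open>h\<close> gains at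
  least \<open>- E' v \<bullet> h - L \<parallel>d\<parallel>\<^sup>2\<close>. As \<open>d\<close> is optimal, the linear term cannot exceed \<open>2 L \<parallel>d\<parallel>\<^sup>2\<close>.
\<close>

lemma gradient_bound_on_cone:
  assumes lip: "L-lipschitz_on K E'" and K: "cball v (norm d) \<subseteq> K" and "\<tau> \<in> S"
  shows "\<bar>E' v \<bullet> \<tau>\<bar> \<le> 2 * L * norm d * norm \<tau>"
proof -
  have "v \<in> K" "v + d \<in> K" using K by (auto simp: dist_norm subset_iff)
  have same_length: "- (2 * L * (norm d)\<^sup>2) \<le> E' v \<bullet> h" if "h \<in> S" "norm h = norm d" for h
  proof -
    have "v + h \<in> K" using K that by (auto simp: dist_norm subset_iff)
    have "E v + E' v \<bullet> d \<le> E (v + d)" using above_tangent_plane[of v "v + d"] by simp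
    moreover have "E (v + d) \<le> E v + E' v \<bullet> h + L * (norm d)\<^sup>2"
      using step_optimal[OF that(1)] quadratic_upper_bound[OF lip \<open>v \<in> K\<close> \<open>v + h \<in> K\<close>] that(2)
      by simp
    moreover have "- (E' v \<bullet> d) \<le> L * (norm d)\<^sup>2"
    proof -
      have "- (E' v \<bullet> d) = (E' (v + d) - E' v) \<bullet> d"
        using gradient_orthogonal_to_step by (simp add: inner_diff_left)
      also have "\<dots> \<le> norm (E' (v + d) - E' v) * norm d" by (rule norm_cauchy_schwarz)
      also have "\<dots> \<le> L * norm d * norm d"
        using lipschitz_onD[OF lip \<open>v + d \<in> K\<close> \<open>v \<in> K\<close>]
        by (intro mult_right_mono) (auto simp: dist_norm)
      finally show ?thesis by (simp add: power2_eq_square)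
    qed
    ultimately show ?thesis by linarith
  qed
  consider "d = 0" | "\<tau> = 0" | "d \<noteq> 0" "\<tau> \<noteq> 0" by blast
  then show ?thesis
  proof cases
    case 1
    then have "E' v \<bullet> \<tau> = 0"
      using gradient_orthogonal_if_line_minimum[of v \<tau>] step_optimal cone \<open>\<tau> \<in> S\<close> by simp
    with 1 show ?thesis by simp
  next
    case 2
    then show ?thesis by simp
  next
    case 3
    define c where "c = norm d / norm \<tau>"
    have "0 < c" and c: "c * norm \<tau> = norm d" using 3 by (simp_all add: c_def)
    have "c *\<^sub>R \<tau> \<in> S" "(- c) *\<^sub>R \<tau> \<in> S" using cone \<open>\<tau> \<in> S\<close> by blast+
    then have "- (2 * L * (norm d)\<^sup>2) \<le> E' v \<bullet> (c *\<^sub>R \<tau>)"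
      "- (2 * L * (norm d)\<^sup>2) \<le> E' v \<bullet> ((- c) *\<^sub>R \<tau>)"
      using c \<open>0 < c\<close> by (simp_all only: same_length norm_scaleR abs_minus abs_of_pos)
    then have "c * \<bar>E' v \<bullet> \<tau>\<bar> \<le> 2 * L * (norm d)\<^sup>2"
      using \<open>0 < c\<close> by (auto simp: abs_if)
    also have "\<dots> = c * (2 * L * norm d * norm \<tau>)"
      using c by (metis (no_types, lifting) mult.assoc mult.commute power2_eq_square)
    finally show ?thesis using \<open>0 < c\<close> by simp
  qed
qed

end

section \<open>Convergence of the greedy iterates\<close>

lemma greedy_converges:
  fixes a :: "nat \<Rightarrow> 'v"
  defines "U \<equiv> \<lambda>n. \<Sum>k<n. a k"
  assumes cone: "\<And>c x. x \<in> S \<Longrightarrow> c *\<^sub>R x \<in> S"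
    and total: "closure (span S) = UNIV"
    and lipschitz: "\<And>K. bounded K \<Longrightarrow> \<exists>L. L-lipschitz_on K E'"
    and a: "\<And>n. a n \<in> S" and optimal: "\<And>n \<tau>. \<tau> \<in> S \<Longrightarrow> E (U n + a n) \<le> E (U n + \<tau>)"
    and u: "\<And>v. E u \<le> E v"
  shows "U \<longlonglongrightarrow> u"
proof -
  have U_Suc: "U (Suc n) = U n + a n" for n by (simp add: U_def)
  have drop: "\<alpha> / 2 * (norm (a n))\<^sup>2 \<le> E (U n) - E (U (Suc n))" for n
    unfolding U_Suc by (rule energy_drop[OF cone a optimal])
  have "decseq (\<lambda>n. E (U n))"
  proof (rule decseq_SucI)
    fix n
    have "0 \<le> \<alpha> / 2 * (norm (a n))\<^sup>2" using modulus_pos by simp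
    with drop[of n] show "E (U (Suc n)) \<le> E (U n)" by linarith
  qed
  have summ: "summable (\<lambda>n. (norm (a n))\<^sup>2)"
  proof (rule bounded_imp_summable)
    fix n
    have "\<alpha> / 2 * (\<Sum>k\<le>n. (norm (a k))\<^sup>2) \<le> (\<Sum>k<Suc n. E (U k) - E (U (Suc k)))"
      unfolding sum_distrib_left lessThan_Suc_atMost by (intro sum_mono drop)
    also have "\<dots> = E (U 0) - E (U (Suc n))"
      by (rule sum_lessThan_telescope')
    also have "\<dots> \<le> E (U 0) - E u" using u by simp
    finally show "(\<Sum>k\<le>n. (norm (a k))\<^sup>2) \<le> 2 / \<alpha> * (E (U 0) - E u)"
      using modulus_pos by (simp add: field_simps)
  qed simp
  have "bounded (range U)"
  proof (rule bounded_subset[OF bounded_sublevel])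
    show "range U \<subseteq> {v. E v \<le> E (U 0)}"
      using \<open>decseq (\<lambda>n. E (U n))\<close> by (auto simp: decseq_def)
  qed
  then obtain R where R: "\<And>n. norm (U n) \<le> R" unfolding bounded_iff by blast
  \<comment> \<open>Since \<open>\<parallel>a\<^sub>n\<parallel> \<le> 2 R\<close>, the ball of radius \<open>\<parallel>a\<^sub>n\<parallel>\<close> around \<open>U n\<close> stays within radius \<open>3 R\<close>.\<close>
  obtain L where L: "L-lipschitz_on (cball 0 (3 * R)) E'"
    using lipschitz bounded_cball by blast
  then have "0 \<le> L" by (rule lipschitz_on_nonneg)
  have ball: "cball (U n) (norm (a n)) \<subseteq> cball 0 (3 * R)" for n
  proof
    fix x assume x: "x \<in> cball (U n) (norm (a n))"
    have "norm (a n) \<le> norm (U (Suc n)) + norm (U n)"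
      unfolding U_Suc using norm_triangle_ineq4[of "U n + a n" "U n"] by simp
    moreover have "norm x \<le> norm (U n) + norm (a n)"
      using x norm_triangle_ineq[of "U n" "x - U n"] by (simp add: dist_norm norm_minus_commute)
    ultimately show "x \<in> cball 0 (3 * R)"
      using R[of n] R[of "Suc n"] by simp
  qed
  have grad: "\<bar>E' (U n) \<bullet> \<tau>\<bar> \<le> 2 * L * norm (a n) * norm \<tau>" if "\<tau> \<in> S" for n \<tau>
    by (rule gradient_bound_on_cone[OF cone a optimal L ball that])

  have grad_null: "(\<lambda>n. E' (U n) \<bullet> u) \<longlonglongrightarrow> 0"
  proof (rule inner_tendsto_zero_if_on_total_set[OF _ _ total])
    show "norm (E' (U n)) \<le> norm (E' 0) + L * R" for n
    proof -
      have "0 \<le> R" using R[of 0] norm_ge_zero[of "U 0"] by linarith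
      then have "dist (E' (U n)) (E' 0) \<le> L * dist (U n) 0"
        using R[of n] by (intro lipschitz_onD[OF L]) auto
      also have "\<dots> \<le> L * R" using R[of n] \<open>0 \<le> L\<close> by (simp add: mult_left_mono)
      finally show ?thesis
        using norm_triangle_ineq[of "E' 0" "E' (U n) - E' 0"] by (simp add: dist_norm)
    qed
  next
    fix \<tau> assume "\<tau> \<in> S"
    have "(\<lambda>n. sqrt ((norm (a n))\<^sup>2)) \<longlonglongrightarrow> sqrt 0"
      by (intro tendsto_real_sqrt summable_LIMSEQ_zero summ)
    then have "(\<lambda>n. 2 * L * norm (a n) * norm \<tau>) \<longlonglongrightarrow> 2 * L * 0 * norm \<tau>"
      by (intro tendsto_intros) simp
    then have "(\<lambda>n. 2 * L * norm (a n) * norm \<tau>) \<longlonglongrightarrow> 0" by simp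
    then show "(\<lambda>n. E' (U n) \<bullet> \<tau>) \<longlonglongrightarrow> 0"
      by (rule Lim_null_comparison[rotated])
        (intro always_eventually allI, unfold real_norm_def, rule grad[OF \<open>\<tau> \<in> S\<close>])
  qed

  have "(\<lambda>n. E (U n) - E u) \<longlonglongrightarrow> 0"
  proof (rule LIMSEQ_I)
    fix e :: real assume "0 < e"
    obtain N where N: "\<And>n. n \<ge> N \<Longrightarrow> \<bar>E' (U n) \<bullet> u\<bar> < e / 2"
      using grad_null \<open>0 < e\<close> by (metis LIMSEQ_D diff_zero half_gt_zero real_norm_def)
    \<comment> \<open>As the energies decrease, a single index with small excess energy suffices. The extra \<open>1\<close>
        next to \<open>2 L\<close> keeps the denominator positive if \<open>L = 0\<close>.\<close>
    have "0 < e / (2 * (2 * L + 1))" using \<open>0 < e\<close> \<open>0 \<le> L\<close> by simp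
    then obtain n where n: "n \<ge> N"
      "norm (a n) * (\<Sum>k<n. norm (a k)) < e / (2 * (2 * L + 1))"
      using square_summable_mult_partial_sum_small[OF _ summ] norm_ge_zero by blast
    have "E' (U n) \<bullet> U n = (\<Sum>k<n. E' (U n) \<bullet> a k)"
      by (simp add: U_def inner_sum_right)
    also have "\<dots> \<le> (\<Sum>k<n. 2 * L * norm (a n) * norm (a k))"
      using grad[OF a] by (intro sum_mono) (meson abs_le_D1)
    also have "\<dots> = 2 * L * (norm (a n) * (\<Sum>k<n. norm (a k)))"
      by (simp add: sum_distrib_left mult.assoc)
    also have "\<dots> \<le> (2 * L + 1) * (norm (a n) * (\<Sum>k<n. norm (a k)))"
      by (intro mult_right_mono mult_nonneg_nonneg sum_nonneg) auto
    also have "\<dots> < e / 2"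
      using n(2) \<open>0 \<le> L\<close> by (simp add: field_simps)
    finally have "E' (U n) \<bullet> U n < e / 2" .
    moreover have "E (U n) - E u \<le> E' (U n) \<bullet> U n - E' (U n) \<bullet> u"
      using above_tangent_plane[of "U n" u] by (simp add: inner_diff_right)
    ultimately have "E (U n) - E u < e"
      using N[OF n(1)] by linarith
    then have "norm (E (U i) - E u - 0) < e" if "i \<ge> n" for i
      using decseqD[OF \<open>decseq (\<lambda>n. E (U n))\<close> that] u[of "U i"] by simp
    then show "\<exists>n. \<forall>i\<ge>n. norm (E (U i) - E u - 0) < e" by blast
  qed
  then have "(\<lambda>n. sqrt (4 / \<alpha> * (E (U n) - E u))) \<longlonglongrightarrow> sqrt (4 / \<alpha> * 0)"
    by (intro tendsto_real_sqrt tendsto_mult_left)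
  then have sqrt_lim: "(\<lambda>n. sqrt (4 / \<alpha> * (E (U n) - E u))) \<longlonglongrightarrow> 0" by simp
  have "norm (U n - u) \<le> sqrt (4 / \<alpha> * (E (U n) - E u))" for n
    using dist_minimizer[OF u, of "U n"] modulus_pos
    by (intro real_le_rsqrt) (simp add: field_simps)
  then have "(\<lambda>n. U n - u) \<longlonglongrightarrow> 0"
    by (intro Lim_null_comparison[OF _ sqrt_lim] always_eventually allI)
  then show ?thesis by (rule Lim_null[THEN iffD2])
qed

end

section \<open>Rank-one elements form a cone\<close>

text \<open>A null set times the whole space is a null set.\<close>

lemma AE_lebesgue_fst:
  fixes P :: "'a::euclidean_space \<Rightarrow> bool"
  assumes "AE t in lebesgue. P t"
  shows "AE z in (lebesgue :: ('a \<times> 'b::euclidean_space) measure). P (fst z)"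
proof -
  have "AE t in lborel. P t" using assms by (simp add: AE_completion_iff)
  then obtain N where N: "{t. \<not> P t} \<subseteq> N" "N \<in> null_sets lborel"
    by (elim AE_E) (auto simp: null_sets_def)
  have [measurable]: "N \<in> sets borel" using N(2) by (auto simp: null_sets_def)
  have "AE z in (lborel :: 'a measure) \<Otimes>\<^sub>M (lborel :: 'b measure). fst z \<notin> N"
  proof (rule lborel_pair.AE_pair_measure)
    show "AE x in lborel. AE y in lborel. fst (x, y :: 'b) \<notin> N"
      using AE_not_in[OF N(2)] by eventually_elim simp
  qed measurable
  then have "AE z in (lborel :: ('a \<times> 'b) measure). P (fst z)"
    unfolding lborel_prod by eventually_elim (use N(1) in auto)
  then show ?thesis by (rule AE_completion)
qed

text \<open>
  Both sides are the function \<open>(t, x) \<mapsto> c r(t) s(x)\<close>, up to the identification, and elements of a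
  Hilbert function space are determined by their functions.
\<close>

lemma tens_scaleR:
  fixes fn_t :: "'vt::{real_inner, complete_space} \<Rightarrow> 'a::euclidean_space \<Rightarrow> real"
    and fn_x :: "'vx \<Rightarrow> 'b::euclidean_space \<Rightarrow> real"
    and fn :: "'v::{real_inner, complete_space} \<Rightarrow> 'a \<times> 'b \<Rightarrow> real"
  assumes t: "hilbert_function_space m T fn_t"
    and v: "hilbert_function_space m (T \<times> X) fn"
    and tens: "is_tensor_product m T X fn_t fn_x fn tens"
  shows "tens (c *\<^sub>R r) s = c *\<^sub>R tens r s"
proof -
  have scale_t: "same_on m T (fn_t (c *\<^sub>R r)) (\<lambda>x. c * fn_t r x)"
    using t by (simp add: hilbert_function_space_def)
  have scale: "same_on m (T \<times> X) (fn (c *\<^sub>R tens r s)) (\<lambda>z. c * fn (tens r s) z)"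
    using v by (simp add: hilbert_function_space_def)
  have prod: "same_on m (T \<times> X) (fn (tens r' s)) (\<lambda>(t, x). fn_t r' t * fn_x s x)" for r'
    using tens by (simp add: is_tensor_product_def)
  have "same_on m (T \<times> X) (fn (tens (c *\<^sub>R r) s)) (fn (c *\<^sub>R tens r s))"
  proof (cases m)
    case Pointwise
    with scale_t scale prod[of r] prod[of "c *\<^sub>R r"] show ?thesis by auto
  next
    case Almost_Everywhere
    then have "AE t in lebesgue. t \<in> T \<longrightarrow> fn_t (c *\<^sub>R r) t = c * fn_t r t"
      using scale_t by simp
    note scale_fst = AE_lebesgue_fst[OF this, where 'b = 'b]
    have "AE z in lebesgue. z \<in> T \<times> X \<longrightarrow> fn (tens (c *\<^sub>R r) s) z = fn (c *\<^sub>R tens r s) z"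
      using scale_fst scale[unfolded Almost_Everywhere, simplified]
        prod[of r, unfolded Almost_Everywhere, simplified]
        prod[of "c *\<^sub>R r", unfolded Almost_Everywhere, simplified]
      by eventually_elim auto
    with Almost_Everywhere show ?thesis by simp
  qed
  with v show ?thesis by (simp add: hilbert_function_space_def)
qed

lemma greedy_choice_iff:
  "greedy_choice E tens r s n \<longleftrightarrow>
    (\<forall>\<tau>\<in>rank_one tens. E ((\<Sum>k=1..n - 1. tens (r k) (s k)) + tens (r n) (s n))
      \<le> E ((\<Sum>k=1..n - 1. tens (r k) (s k)) + \<tau>))"
  by (auto simp: greedy_choice_def greedy_objective_def is_arg_min_def rank_one_def not_less)

section \<open>The greedy algorithm\<close>

theorem theorem2p1:
  fixes T :: "(real ^ 'p) set" and X :: "(real ^ 'd) set"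
    and m :: identification
    and fn_t :: "'vt::{real_inner, complete_space} \<Rightarrow> real ^ 'p \<Rightarrow> real"
    and fn_x :: "'vx::{real_inner, complete_space} \<Rightarrow> real ^ 'd \<Rightarrow> real"
    and fn :: "'v::{real_inner, complete_space} \<Rightarrow> (real ^ 'p) \<times> (real ^ 'd) \<Rightarrow> real"
    and tens :: "'vt \<Rightarrow> 'vx \<Rightarrow> 'v"
    and E :: "'v \<Rightarrow> real" and E' :: "'v \<Rightarrow> 'v"
  assumes "open T" and "open X"
    and "hilbert_function_space m T fn_t"
    and "hilbert_function_space m X fn_x"
    and "hilbert_function_space m (T \<times> X) fn"
    and "is_tensor_product m T X fn_t fn_x fn tens"
    and gradient: "\<And>v. GDERIV E v :> E' v"
    and A1: "closure (span (rank_one tens)) = UNIV"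
    and A2: "\<And>\<sigma> :: nat \<Rightarrow> 'v. (\<And>n. \<sigma> n \<in> rank_one tens) \<Longrightarrow> bounded (range \<sigma>) \<Longrightarrow>
               \<exists>l\<in>rank_one tens. \<exists>\<phi>. strict_mono \<phi> \<and> converges_weakly (\<sigma> \<circ> \<phi>) l"
    and A3: "strongly_convex E E'"
    and A4: "\<And>K. bounded K \<Longrightarrow> \<exists>L. L-lipschitz_on K E'"
  shows "(\<forall>n\<ge>1. \<forall>r s. (\<forall>k\<in>{1..<n}. greedy_choice E tens r s k) \<longrightarrow>
            (\<exists>r' s'. is_arg_min (greedy_objective E tens r s n) (\<lambda>_. True) (r', s'))) \<and>
         (\<exists>u. (\<forall>v. is_arg_min E (\<lambda>_. True) v \<longleftrightarrow> v = u) \<and>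
            (\<forall>r s. (\<forall>n\<ge>1. greedy_choice E tens r s n) \<longrightarrow>
               (\<lambda>n. \<Sum>k=1..n. tens (r k) (s k)) \<longlonglongrightarrow> u))"
proof -
  obtain \<alpha> where "0 < \<alpha>"
    and convex: "\<And>v w. E v \<ge> E w + E' w \<bullet> (v - w) + \<alpha> / 2 * (norm (v - w))\<^sup>2"
    using A3 unfolding strongly_convex_def by blast
  interpret strongly_convex_functional E E' \<alpha>
    by unfold_locales (use gradient \<open>0 < \<alpha>\<close> convex in auto)
  let ?S = "rank_one tens"
  have cone: "c *\<^sub>R x \<in> ?S" if "x \<in> ?S" for c x
    using that tens_scaleR[OF assms(3,5,6)] unfolding rank_one_def by (smt (verit) mem_Collect_eq)
  have "?S \<noteq> {}" unfolding rank_one_def by blast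
  show ?thesis
  proof (rule conjI)
    show "\<forall>n\<ge>1. \<forall>r s. (\<forall>k\<in>{1..<n}. greedy_choice E tens r s k) \<longrightarrow>
            (\<exists>r' s'. is_arg_min (greedy_objective E tens r s n) (\<lambda>_. True) (r', s'))"
    proof (intro allI impI)
      fix n and r :: "nat \<Rightarrow> 'vt" and s :: "nat \<Rightarrow> 'vx"
      obtain l where "l \<in> ?S"
        and l: "\<forall>\<tau>\<in>?S. E ((\<Sum>k=1..n - 1. tens (r k) (s k)) + l)
          \<le> E ((\<Sum>k=1..n - 1. tens (r k) (s k)) + \<tau>)"
        using minimizer_on_translate[OF \<open>?S \<noteq> {}\<close> A2] by blast
      then obtain r' s' where "l = tens r' s'" unfolding rank_one_def by blast
      with l have "is_arg_min (greedy_objective E tens r s n) (\<lambda>_. True) (r', s')"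
        by (auto simp: greedy_objective_def is_arg_min_def rank_one_def not_less)
      then show "\<exists>r' s'. is_arg_min (greedy_objective E tens r s n) (\<lambda>_. True) (r', s')"
        by blast
    qed
  next
    obtain u where u: "\<And>v. E u \<le> E v" using minimizer by blast
    show "\<exists>u. (\<forall>v. is_arg_min E (\<lambda>_. True) v \<longleftrightarrow> v = u) \<and>
            (\<forall>r s. (\<forall>n\<ge>1. greedy_choice E tens r s n) \<longrightarrow>
               (\<lambda>n. \<Sum>k=1..n. tens (r k) (s k)) \<longlonglongrightarrow> u)"
    proof (intro exI[of _ u] conjI allI impI)
      show "is_arg_min E (\<lambda>_. True) v \<longleftrightarrow> v = u" for v
        by (rule is_arg_min_iff[OF u])
    next
      fix r :: "nat \<Rightarrow> 'vt" and s :: "nat \<Rightarrow> 'vx"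
      assume greedy: "\<forall>n\<ge>1. greedy_choice E tens r s n"
      define a where "a k = tens (r (Suc k)) (s (Suc k))" for k
      have iterate: "(\<Sum>k=1..n. tens (r k) (s k)) = (\<Sum>k<n. a k)" for n
        unfolding a_def by (simp add: sum.atLeast1_atMost_eq)
      have "(\<lambda>n. \<Sum>k<n. a k) \<longlonglongrightarrow> u"
      proof (rule greedy_converges[OF cone A1 A4 _ _ u])
        show "a n \<in> ?S" for n unfolding a_def rank_one_def by blast
      next
        fix n \<tau> assume "\<tau> \<in> ?S"
        moreover have "greedy_choice E tens r s (Suc n)" using greedy by simp
        ultimately show "E ((\<Sum>k<n. a k) + a n) \<le> E ((\<Sum>k<n. a k) + \<tau>)"
          unfolding greedy_choice_iff diff_Suc_1 iterate a_def[symmetric] by blast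
      qed
      then show "(\<lambda>n. \<Sum>k=1..n. tens (r k) (s k)) \<longlonglongrightarrow> u"
        unfolding iterate .
    qed
  qed
qed

end
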